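(* Let $k\ge1$, let $\mathbf n=(n_1,\dots,n_k)$ be positive integers, and let $S\subseteq\{1,\dots,k\}$. For each $i\in S$ let $X_i$ be a restriction on the run lengths of letter $i$, and let $U(n_i,r_i;X_i)$ be the number of arrangements of $n_i$ elements of letter $i$ in exactly $r_i$ runs that satisfy $X_i$. Let $R(\mathbf n;S)$ be the number of words containing exactly $n_i$ copies of letter $i$ ($1\le i\le k$) such that, for every $i\in S$, the runs of letter $i$ satisfy $X_i$ (with no restriction on the letters $i\notin S$). Then $$R(\mathbf n;S)=\sum_{\substack{1\le p_i\le r_i\le n_i\\ i\in S}}\frac{\left(\sum_{i\in S}p_i+\sum_{i\notin S}n_i\right)!}{\prod_{i\in S}p_i!\,\prod_{i\notin S}n_i!}\;\prod_{i\in S}(-1)^{r_i-p_i}\binom{r_i-1}{p_i-1}U(n_i,r_i;X_i),$$ where the sum is over all integers $r_i,p_i$ ($i\in S$) in the indicated range.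
   Context: Words are finite linear sequences over the alphabet $\{1,\dots,k\}$; copies of the same letter are indistinguishable. A run of letter $i$ is a maximal block of consecutive occurrences of letter $i$. Reading the runs of letter $i$ from left to right, their lengths form a composition (ordered sequence of positive integers) of $n_i$ into $r_i$ parts, where $r_i$ is the number of runs of letter $i$. A restriction $X_i$ is an arbitrary condition on this composition (i.e. an arbitrary set of compositions of $n_i$), and $U(n_i,r_i;X_i)$ is the number of compositions of $n_i$ into exactly $r_i$ positive parts satisfying $X_i$. *)

theory Defs
  imports Complex_Main "HOL-Library.FuncSet"
begin

function runs :: "'a list \<Rightarrow> 'a list list" where
  "runs [] = []"
| "runs (x # xs) = (x # takeWhile (\<lambda>y. y = x) xs) # runs (dropWhile (\<lambda>y. y = x) xs)"
  by pat_completeness auto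
termination
  by (relation "measure length") (auto simp: le_imp_less_Suc length_dropWhile_le)

(* The next three lemmas say that runs splits a word into its maximal constant blocks. *)

lemma concat_runs: "concat (runs w) = w"
  by (induction w rule: runs.induct) simp_all

lemma runs_constant: "b \<in> set (runs w) \<Longrightarrow> b \<noteq> [] \<and> (\<forall>y\<in>set b. y = hd b)"
proof (induction w rule: runs.induct)
  case 1
  then show ?case by simp
next
  case (2 x xs)
  from 2(2) consider "b = x # takeWhile (\<lambda>y. y = x) xs" | "b \<in> set (runs (dropWhile (\<lambda>y. y = x) xs))"
    by (simp only: runs.simps list.set) blast
  then show ?case
  proof cases
    case 1
    have "y = x" if "y \<in> set (takeWhile (\<lambda>y. y = x) xs)" for y
      using set_takeWhileD[OF that] by (rule conjunct2)
    then show ?thesis unfolding 1 list.sel list.set by blast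
  next
    case 2
    then show ?thesis by (rule "2.IH")
  qed
qed

lemma runs_maximal: "Suc j < length (runs w) \<Longrightarrow> hd (runs w ! j) \<noteq> hd (runs w ! Suc j)"
proof (induction w arbitrary: j rule: runs.induct)
  case 1
  then show ?case by simp
next
  case (2 x xs)
  show ?case
  proof (cases j)
    case 0
    with 2(2) obtain y ys where eq: "dropWhile (\<lambda>y. y = x) xs = y # ys"
      by (cases "dropWhile (\<lambda>y. y = x) xs") auto
    then have "y \<noteq> x"
      using hd_dropWhile[of "\<lambda>y. y = x" xs] by simp
    with 0 eq show ?thesis by simp
  next
    case (Suc m)
    with 2(2) have "Suc m < length (runs (dropWhile (\<lambda>y. y = x) xs))" by simp
    from 2(1)[OF this] Suc show ?thesis by simp
  qed
qed

definition run_lengths :: "'a \<Rightarrow> 'a list \<Rightarrow> nat list" where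
  "run_lengths i w = map length (filter (\<lambda>b. hd b = i) (runs w))"

definition compositions :: "nat \<Rightarrow> nat \<Rightarrow> nat list set" where
  "compositions n r = {c. length c = r \<and> (\<forall>m\<in>set c. 0 < m) \<and> sum_list c = n}"

(* A restriction on run lengths is a set X of lists; only its members that are
   compositions of n matter. *)

definition U :: "nat \<Rightarrow> nat \<Rightarrow> nat list set \<Rightarrow> nat" where
  "U n r X = card {c \<in> compositions n r. c \<in> X}"

definition words :: "nat \<Rightarrow> (nat \<Rightarrow> nat) \<Rightarrow> nat list set" where
  "words k n = {w. set w \<subseteq> {1..k} \<and> (\<forall>i\<in>{1..k}. count_list w i = n i)}"

definition R :: "nat \<Rightarrow> (nat \<Rightarrow> nat) \<Rightarrow> nat set \<Rightarrow> (nat \<Rightarrow> nat list set) \<Rightarrow> nat" where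
  "R k n S X = card {w \<in> words k n. \<forall>i\<in>S. run_lengths i w \<in> X i}"

end

theory Submission
  imports Defs "HOL-Combinatorics.Multiset_Permutations"
begin

text \<open>
  Restrictions are added one letter at a time. Replacing the run lengths of a letter \<open>s\<close> by another
  composition with the same number of parts leaves the runs of all other letters untouched, so the
  number of words in which the run lengths of \<open>s\<close> are a given composition depends only on its
  number \<open>r\<close> of parts; it equals the number \<open>A r\<close> of words with \<open>r\<close> isolated copies of \<open>s\<close>. Hence
  imposing a restriction on \<open>s\<close> gives \<open>\<Sum>r. U (n s) r (X s) * A r\<close>. For the trivial restriction
  \<open>U\<close> is a binomial coefficient, and binomial inversion expresses \<open>A r\<close> through the counts
  without a restriction on \<open>s\<close>. When no restriction is left, the count is a multinomial coefficient.
\<close>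

section \<open>Words read run by run\<close>

lemma runs_replicate_append:
  assumes "0 < m" and "ys = [] \<or> hd ys \<noteq> x"
  shows "runs (replicate m x @ ys) = replicate m x # runs ys"
proof -
  from assms(1) obtain l where m: "m = Suc l" by (cases m) auto
  have "takeWhile (\<lambda>y. y = x) ys = []" "dropWhile (\<lambda>y. y = x) ys = ys"
    using assms(2) by (cases ys; simp)+
  then have "takeWhile (\<lambda>y. y = x) (replicate l x @ ys) = replicate l x"
    "dropWhile (\<lambda>y. y = x) (replicate l x @ ys) = ys" for l
    by (induction l) simp_all
  then show ?thesis by (simp add: m)
qed

text \<open>The side condition makes \<open>replicate m x\<close> exactly the first run, so anything
  defined through \<open>runs\<close> unfolds by one step in the induction step.\<close>

lemma run_induct [case_names Nil run]:
  assumes "P []"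
    and "\<And>m x ys. 0 < m \<Longrightarrow> ys = [] \<or> hd ys \<noteq> x \<Longrightarrow> P ys \<Longrightarrow> P (replicate m x @ ys)"
  shows "P w"
proof (induction w rule: runs.induct)
  case 1
  show ?case by (rule assms(1))
next
  case (2 x xs)
  let ?t = "takeWhile (\<lambda>y. y = x) xs" and ?d = "dropWhile (\<lambda>y. y = x) xs"
  have "x # ?t = replicate (length (x # ?t)) x"
    by (rule replicate_length_same[symmetric]) (auto dest: set_takeWhileD)
  then have "x # xs = replicate (length (x # ?t)) x @ ?d"
    by (metis append_Cons takeWhile_dropWhile_id)
  moreover have "?d = [] \<or> hd ?d \<noteq> x"
    using hd_dropWhile[of "\<lambda>y. y = x" xs] by blast
  ultimately show ?case
    using assms(2)[of "length (x # ?t)" ?d x] "2.IH" by simp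
qed

lemma run_lengths_Nil [simp]: "run_lengths i [] = []"
  by (simp add: run_lengths_def)

lemma run_lengths_replicate_append:
  assumes "0 < m" and "ys = [] \<or> hd ys \<noteq> x"
  shows "run_lengths i (replicate m x @ ys) =
    (if x = i then m # run_lengths i ys else run_lengths i ys)"
  using assms by (simp add: run_lengths_def runs_replicate_append)

lemma sum_list_run_lengths: "sum_list (run_lengths i w) = count_list w i"
proof -
  have "count_list (replicate m x) i = (if x = i then m else 0)" for m x
    by (induction m) auto
  then show ?thesis
    by (induction w rule: run_induct) (simp_all add: run_lengths_replicate_append)
qed

lemma run_lengths_pos: "m \<in> set (run_lengths i w) \<Longrightarrow> 0 < m"
  by (induction w rule: run_induct) (auto simp: run_lengths_replicate_append split: if_splits)

lemma run_lengths_eq_Nil_iff: "run_lengths i w = [] \<longleftrightarrow> i \<notin> set w"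
  by (induction w rule: run_induct) (auto simp: run_lengths_replicate_append)

text \<open>Membership in \<open>words k n\<close> becomes a condition on each letter's run lengths
  separately, which is what survives a change of the runs of a single letter.\<close>

lemma words_run_lengths:
  "w \<in> words k n \<longleftrightarrow>
    (\<forall>i. i \<notin> {1..k} \<longrightarrow> run_lengths i w = []) \<and> (\<forall>i\<in>{1..k}. sum_list (run_lengths i w) = n i)"
  by (auto simp: words_def sum_list_run_lengths run_lengths_eq_Nil_iff)

section \<open>Replacing the run lengths of one letter\<close>

text \<open>Each run of \<open>s\<close> consumes one entry of \<open>c\<close>. The result is
  meaningful when \<open>c\<close> has as many entries as there are runs of \<open>s\<close>;
  otherwise \<open>hd []\<close> may be reached or entries are left over.\<close>

primrec rerun :: "'a \<Rightarrow> nat list \<Rightarrow> 'a list list \<Rightarrow> 'a list" where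
  "rerun s c [] = []"
| "rerun s c (b # bs) =
    (if hd b = s then replicate (hd c) s @ rerun s (tl c) bs else b @ rerun s c bs)"

definition set_runs :: "'a \<Rightarrow> nat list \<Rightarrow> 'a list \<Rightarrow> 'a list" where
  "set_runs s c w = rerun s c (runs w)"

lemma set_runs_Nil [simp]: "set_runs s c [] = []"
  by (simp add: set_runs_def)

lemma set_runs_replicate_append:
  assumes "0 < m" and "ys = [] \<or> hd ys \<noteq> x"
  shows "set_runs s c (replicate m x @ ys) =
    (if x = s then replicate (hd c) s @ set_runs s (tl c) ys else replicate m x @ set_runs s c ys)"
  using assms by (simp add: set_runs_def runs_replicate_append)

text \<open>Positive new lengths keep every run nonempty. So no run disappears, and neighbouring
  runs of other letters cannot merge.\<close>

lemma set_runs_hd: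
  assumes "length c = length (run_lengths s w)" and "\<forall>m\<in>set c. 0 < m"
  shows "(set_runs s c w = [] \<longleftrightarrow> w = []) \<and> hd (set_runs s c w) = hd w"
  using assms
proof (induction w arbitrary: c rule: run_induct)
  case (run m x ys)
  then show ?case
    by (cases c) (auto simp: set_runs_replicate_append run_lengths_replicate_append hd_append)
qed simp

lemma set_runs_hd_neq:
  assumes "length c = length (run_lengths s w)" and "\<forall>m\<in>set c. 0 < m"
    and "w = [] \<or> hd w \<noteq> x"
  shows "set_runs s c w = [] \<or> hd (set_runs s c w) \<noteq> x"
  using set_runs_hd[OF assms(1,2)] assms(3) by simp

text \<open>By \<open>set_runs_hd_neq\<close>, the changed rest of the word still does not start
  with the letter of the run before it, so the new blocks are again maximal.\<close>

lemma run_lengths_set_runs: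
  assumes "length c = length (run_lengths s w)" and "\<forall>m\<in>set c. 0 < m"
  shows "run_lengths i (set_runs s c w) = (if i = s then c else run_lengths i w)"
  using assms
proof (induction w arbitrary: c rule: run_induct)
  case (run m x ys)
  show ?case
  proof (cases "x = s")
    case True
    with run.prems run.hyps obtain l c' where c: "c = l # c'"
      by (cases c) (auto simp: run_lengths_replicate_append)
    have c': "length c' = length (run_lengths s ys)" "\<forall>m\<in>set c'. 0 < m" "0 < l"
      using run.prems run.hyps True c by (auto simp: run_lengths_replicate_append)
    show ?thesis
      using set_runs_hd_neq[OF c'(1,2) run.hyps(2)] run.IH[OF c'(1,2)] run.hyps c' True c
      by (auto simp: set_runs_replicate_append run_lengths_replicate_append)
  next
    case False
    have c: "length c = length (run_lengths s ys)"
      using run.prems(1) run.hyps False by (simp add: run_lengths_replicate_append)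
    show ?thesis
      using set_runs_hd_neq[OF c run.prems(2) run.hyps(2)] run.IH[OF c run.prems(2)] run.hyps False
      by (auto simp: set_runs_replicate_append run_lengths_replicate_append)
  qed
qed simp

text \<open>The first replacement leaves the order of the runs intact, so the second overwrites the
  same runs. With \<open>d\<close> the original run lengths this gives back \<open>w\<close>, by
  \<open>set_runs_run_lengths\<close>.\<close>

lemma set_runs_set_runs:
  assumes "length c = length (run_lengths s w)" and "\<forall>m\<in>set c. 0 < m"
  shows "set_runs s d (set_runs s c w) = set_runs s d w"
  using assms
proof (induction w arbitrary: c d rule: run_induct)
  case (run m x ys)
  show ?case
  proof (cases "x = s")
    case True
    with run.prems run.hyps obtain l c' where c: "c = l # c'"
      by (cases c) (auto simp: run_lengths_replicate_append)
    have c': "length c' = length (run_lengths s ys)" "\<forall>m\<in>set c'. 0 < m" "0 < l"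
      using run.prems run.hyps True c by (auto simp: run_lengths_replicate_append)
    show ?thesis
      using set_runs_hd_neq[OF c'(1,2) run.hyps(2)] run.IH[OF c'(1,2)] run.hyps c' True c
      by (auto simp: set_runs_replicate_append)
  next
    case False
    have c: "length c = length (run_lengths s ys)"
      using run.prems(1) run.hyps False by (simp add: run_lengths_replicate_append)
    show ?thesis
      using set_runs_hd_neq[OF c run.prems(2) run.hyps(2)] run.IH[OF c run.prems(2)] run.hyps False
      by (auto simp: set_runs_replicate_append)
  qed
qed simp

lemma set_runs_run_lengths: "set_runs s (run_lengths s w) w = w"
  by (induction w rule: run_induct)
    (auto simp: set_runs_replicate_append run_lengths_replicate_append)

text \<open>\<open>set_runs s d\<close> and \<open>set_runs s c\<close> are mutually inverse
  bijections between the two sets. The last assumption says that \<open>P\<close> sees only the run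
  lengths of letters other than \<open>s\<close>, which these maps preserve.\<close>

lemma card_run_lengths_eq:
  assumes len: "length c = length d"
    and c: "\<forall>m\<in>set c. 0 < m" and d: "\<forall>m\<in>set d. 0 < m"
    and P: "\<And>v w. (\<And>i. i \<noteq> s \<Longrightarrow> run_lengths i v = run_lengths i w) \<Longrightarrow> P v = P w"
  shows "card {w. P w \<and> run_lengths s w = c} = card {w. P w \<and> run_lengths s w = d}"
proof (rule bij_betw_same_card)
  have P': "P (set_runs s e w) = P w"
    if "length e = length (run_lengths s w)" "\<forall>m\<in>set e. 0 < m" for e w
    using that by (intro P) (simp add: run_lengths_set_runs)
  show "bij_betw (set_runs s d) {w. P w \<and> run_lengths s w = c} {w. P w \<and> run_lengths s w = d}"
    by (rule bij_betw_byWitness[where f' = "set_runs s c"])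
      (use len in \<open>auto simp: c d P' set_runs_set_runs set_runs_run_lengths run_lengths_set_runs\<close>)
qed

section \<open>Counting compositions and unrestricted words\<close>

lemma finite_compositions: "finite (compositions n r)"
proof (rule finite_subset)
  show "compositions n r \<subseteq> {c. set c \<subseteq> {..n} \<and> length c = r}"
    by (auto simp: compositions_def member_le_sum_list)
qed (simp add: finite_lists_length_eq)

text \<open>Subtracting 1 from every part leaves \<open>r\<close> nonnegative parts with sum
  \<open>n - r\<close>, which stars and bars counts.\<close>

lemma card_compositions:
  assumes "1 \<le> r" and "r \<le> n"
  shows "card (compositions n r) = (n - 1) choose (r - 1)"
proof -
  have sum_suc: "sum_list (map Suc d) = sum_list d + length d" for d :: "nat list"
    by (induction d) simp_all
  have "compositions n r = map Suc ` {c. length c = r \<and> sum_list c = n - r}"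
  proof (rule set_eqI, rule iffI)
    fix c assume c: "c \<in> compositions n r"
    have "map Suc (map (\<lambda>m. m - 1) c) = c"
      using c by (auto simp: compositions_def intro!: map_idI)
    then have "sum_list (map (\<lambda>m. m - 1) c) = n - r"
      using c sum_suc by (metis (mono_tags, lifting) add_diff_cancel_right' compositions_def length_map mem_Collect_eq)
    with \<open>map Suc _ = c\<close> show "c \<in> map Suc ` {c. length c = r \<and> sum_list c = n - r}"
      using c by (intro image_eqI[of _ _ "map (\<lambda>m. m - 1) c"]) (auto simp: compositions_def)
  next
    fix c assume "c \<in> map Suc ` {c. length c = r \<and> sum_list c = n - r}"
    then show "c \<in> compositions n r"
      using assms by (auto simp: compositions_def sum_suc)
  qed
  moreover have "inj_on (map Suc) A" for A
    by (rule inj_on_subset[of _ UNIV]) simp_all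
  ultimately have "card (compositions n r) = card {c :: nat list. length c = r \<and> sum_list c = n - r}"
    by (simp add: card_image)
  also have "\<dots> = (n - 1) choose (n - r)"
    using assms by (simp add: card_length_sum_list)
  also have "\<dots> = (n - 1) choose (r - 1)"
    using assms by (subst binomial_symmetric) auto
  finally show ?thesis .
qed

lemma words_eq_permutations:
  "words k n = permutations_of_multiset (\<Sum>i\<in>{1..k}. replicate_mset (n i) i)"
proof -
  have "count (\<Sum>i\<in>{1..k}. replicate_mset (n i) i) j = (if j \<in> {1..k} then n j else 0)" for j
    by (simp add: count_sum)
  moreover have "count (mset w) j = count_list w j" for w :: "nat list" and j
    by (induction w) simp_all
  ultimately have "mset w = (\<Sum>i\<in>{1..k}. replicate_mset (n i) i) \<longleftrightarrow>
      (\<forall>j. count_list w j = (if j \<in> {1..k} then n j else 0))" for w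
    by (simp only: multiset_eq_iff)
  moreover have "w \<in> words k n \<longleftrightarrow> (\<forall>j. count_list w j = (if j \<in> {1..k} then n j else 0))" for w
    unfolding words_def mem_Collect_eq subset_iff by (metis count_list_0_iff)
  ultimately show ?thesis
    by (auto simp: permutations_of_multiset_def)
qed

lemma finite_words: "finite (words k n)"
  by (simp add: words_eq_permutations)

lemma card_words:
  assumes "\<And>i. i \<in> {1..k} \<Longrightarrow> 1 \<le> n i"
  shows "real (card (words k n)) = fact (\<Sum>i\<in>{1..k}. n i) / (\<Prod>i\<in>{1..k}. fact (n i))"
proof -
  define M where "M = (\<Sum>i\<in>{1..k}. replicate_mset (n i) i)"
  have count: "count M j = (if j \<in> {1..k} then n j else 0)" for j
    by (simp add: M_def count_sum)
  \<comment> \<open>The count of multiset permutations has a product over the letters that occur;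
    positivity of all \<open>n i\<close> makes these exactly \<open>{1..k}\<close>.\<close>
  have "set_mset M = {1..k}"
  proof (rule set_eqI)
    fix i show "i \<in> set_mset M \<longleftrightarrow> i \<in> {1..k}"
      using assms[of i] by (auto simp: count simp flip: count_greater_zero_iff)
  qed
  moreover have "size M = (\<Sum>i\<in>{1..k}. n i)"
    by (simp add: M_def size_multiset_sum)
  moreover have "words k n = permutations_of_multiset M"
    by (simp add: M_def words_eq_permutations)
  ultimately have "card (words k n) * (\<Prod>i\<in>{1..k}. fact (n i)) = fact (\<Sum>i\<in>{1..k}. n i)"
    using card_permutations_of_multiset_aux[of M] by (simp add: count)
  from arg_cong[where f = real, OF this]
  have "real (card (words k n)) * (\<Prod>i\<in>{1..k}. fact (n i)) = fact (\<Sum>i\<in>{1..k}. n i)"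
    by (simp only: of_nat_fact of_nat_mult of_nat_prod)
  then show ?thesis
    by (simp add: field_simps)
qed

section \<open>Binomial inversion\<close>

text \<open>Orthogonality of the binomial coefficients: \<open>choose_mult\<close> pulls out
  \<open>m choose j\<close>, and what remains is the expansion of
  \<open>(1 + (-1)) ^ (m - j)\<close>.\<close>

lemma alternating_sum_choose_mult:
  assumes "j \<le> m"
  shows "(\<Sum>p\<le>m. (-1) ^ (m - p) * real (m choose p) * real (p choose j)) = (if j = m then 1 else 0)"
proof -
  have "(\<Sum>p\<le>m. (-1) ^ (m - p) * real (m choose p) * real (p choose j)) =
      (\<Sum>p\<in>{j..m}. (-1) ^ (m - p) * real (m choose p) * real (p choose j))"
    by (rule sum.mono_neutral_right) auto
  \<comment> \<open>The substitution is \<open>q = p - j\<close>; the factor \<open>1 ^ q\<close>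
    gives the summand the shape of \<open>binomial_ring\<close>.\<close>
  also have "\<dots> = (\<Sum>q\<le>m - j. real (m choose j) * (real ((m - j) choose q) * 1 ^ q * (-1) ^ (m - j - q)))"
  proof (rule sum.reindex_bij_witness[of _ "\<lambda>q. q + j" "\<lambda>p. p - j"], goal_cases)
    case (5 p)
    then have "real ((m choose p) * (p choose j)) = real ((m choose j) * ((m - j) choose (p - j)))"
      by (simp only: choose_mult atLeastAtMost_iff)
    moreover have "m - j - (p - j) = m - p"
      using 5 by simp
    ultimately show ?case by simp
  qed (use assms in auto)
  also have "\<dots> = real (m choose j) * (1 + (-1)) ^ (m - j)"
    by (simp only: sum_distrib_left binomial_ring)
  finally show ?thesis
    using assms by (simp add: power_0_left)
qed

lemma binomial_inversion:
  fixes f g :: "nat \<Rightarrow> real"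
  assumes "\<And>m. f m = (\<Sum>j\<le>m. real (m choose j) * g j)"
  shows "g m = (\<Sum>p\<le>m. (-1) ^ (m - p) * real (m choose p) * f p)"
proof -
  \<comment> \<open>Terms with \<open>j > p\<close> vanish, so all inner sums get the common bound
    \<open>m\<close> and the two sums can be swapped.\<close>
  have "f p = (\<Sum>j\<le>m. real (p choose j) * g j)" if "p \<le> m" for p
    unfolding assms by (rule sum.mono_neutral_left) (use that in auto)
  then have "(\<Sum>p\<le>m. (-1) ^ (m - p) * real (m choose p) * f p) =
      (\<Sum>p\<le>m. \<Sum>j\<le>m. g j * ((-1) ^ (m - p) * real (m choose p) * real (p choose j)))"
    by (intro sum.cong refl) (simp add: sum_distrib_left mult_ac)
  also have "\<dots> = (\<Sum>j\<le>m. g j * (\<Sum>p\<le>m. (-1) ^ (m - p) * real (m choose p) * real (p choose j)))"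
    by (subst sum.swap) (simp add: sum_distrib_left)
  also have "\<dots> = (\<Sum>j\<le>m. if j = m then g j else 0)"
    by (intro sum.cong refl) (simp add: alternating_sum_choose_mult)
  finally show ?thesis by simp
qed

text \<open>Both indices are shifted by one to fit the composition numbers
  \<open>(m - 1) choose (j - 1)\<close>; the sign exponent \<open>m - p\<close> is invariant under
  the shift.\<close>

lemma binomial_inversion_from_1:
  fixes f g :: "nat \<Rightarrow> real"
  assumes "\<And>m. 1 \<le> m \<Longrightarrow> f m = (\<Sum>j\<in>{1..m}. real ((m - 1) choose (j - 1)) * g j)" and "1 \<le> m"
  shows "g m = (\<Sum>p\<in>{1..m}. (-1) ^ (m - p) * real ((m - 1) choose (p - 1)) * f p)"
proof -
  have shift: "(\<Sum>j\<in>{1..Suc l}. h j) = (\<Sum>j\<le>l. h (Suc j))" for l and h :: "nat \<Rightarrow> real"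
    using sum.atLeast_Suc_atMost_Suc_shift[of h 0 l] by (simp add: atLeast0AtMost)
  obtain l where l: "m = Suc l"
    using assms(2) by (cases m) auto
  have "f (Suc l) = (\<Sum>j\<le>l. real (l choose j) * g (Suc j))" for l
    using assms(1)[of "Suc l"] unfolding shift by simp
  from binomial_inversion[of "\<lambda>l. f (Suc l)" "\<lambda>l. g (Suc l)", OF this, of l]
  show ?thesis unfolding l shift by simp
qed

section \<open>Restricting one more letter\<close>

text \<open>This is \<open>A r\<close> of the outline: every run of \<open>s\<close> is shrunk to
  one copy. Hence the update \<open>n(s := r)\<close>, which also makes the count independent of
  \<open>n s\<close>.\<close>

definition R_isolated :: "nat \<Rightarrow> (nat \<Rightarrow> nat) \<Rightarrow> nat set \<Rightarrow> (nat \<Rightarrow> nat list set) \<Rightarrow> nat \<Rightarrow> nat \<Rightarrow> nat" where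
  "R_isolated k n S X s r = card {w \<in> words k (n(s := r)).
     (\<forall>i\<in>S. run_lengths i w \<in> X i) \<and> run_lengths s w = replicate r 1}"

lemma card_run_lengths_eq_R_isolated:
  assumes "s \<in> {1..k}" and "s \<notin> S" and c: "c \<in> compositions (n s) r"
  shows "card {w \<in> words k n. (\<forall>i\<in>S. run_lengths i w \<in> X i) \<and> run_lengths s w = c} = R_isolated k n S X s r"
proof -
  \<comment> \<open>\<open>P\<close> keeps the conditions that do not concern \<open>s\<close>. The
    required total for \<open>s\<close>, namely \<open>n s\<close> or \<open>r\<close>, follows from
    its prescribed run lengths.\<close>
  define P where "P w \<longleftrightarrow> (\<forall>i. i \<notin> {1..k} \<longrightarrow> run_lengths i w = []) \<and>
    (\<forall>i\<in>{1..k} - {s}. sum_list (run_lengths i w) = n i) \<and> (\<forall>i\<in>S. run_lengths i w \<in> X i)" for w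
  have "{w \<in> words k n. (\<forall>i\<in>S. run_lengths i w \<in> X i) \<and> run_lengths s w = c} =
      {w. P w \<and> run_lengths s w = c}"
    using assms by (auto simp: P_def words_run_lengths compositions_def)
  moreover have "{w \<in> words k (n(s := r)).
      (\<forall>i\<in>S. run_lengths i w \<in> X i) \<and> run_lengths s w = replicate r 1} =
      {w. P w \<and> run_lengths s w = replicate r 1}"
    using assms by (auto simp: P_def words_run_lengths sum_list_replicate)
  moreover have "card {w. P w \<and> run_lengths s w = c} = card {w. P w \<and> run_lengths s w = replicate r 1}"
  proof (rule card_run_lengths_eq)
    fix v w :: "nat list" assume *: "\<And>i. i \<noteq> s \<Longrightarrow> run_lengths i v = run_lengths i w"
    have "(\<forall>i. i \<notin> {1..k} \<longrightarrow> run_lengths i v = []) \<longleftrightarrow> (\<forall>i. i \<notin> {1..k} \<longrightarrow> run_lengths i w = [])"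
      using assms(1) by (metis *)
    moreover have "(\<forall>i\<in>{1..k} - {s}. sum_list (run_lengths i v) = n i) \<longleftrightarrow>
        (\<forall>i\<in>{1..k} - {s}. sum_list (run_lengths i w) = n i)"
      by (intro ball_cong refl) (simp add: *)
    moreover have "(\<forall>i\<in>S. run_lengths i v \<in> X i) \<longleftrightarrow> (\<forall>i\<in>S. run_lengths i w \<in> X i)"
      using assms(2) by (intro ball_cong refl) (metis *)
    ultimately show "P v = P w"
      by (simp only: P_def)
  qed (use c in \<open>auto simp: compositions_def\<close>)
  ultimately show ?thesis
    by (simp add: R_isolated_def)
qed

text \<open>The words are sorted by the run lengths \<open>c\<close> of \<open>s\<close>, and all
  classes with \<open>length c = r\<close> have the same size. Since \<open>n s\<close> is positive
  and runs are nonempty, \<open>r\<close> lies in \<open>{1..n s}\<close>.\<close>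

lemma R_insert_eq_sum:
  assumes "s \<in> {1..k}" and "s \<notin> S" and "1 \<le> n s"
  shows "R k n (insert s S) X = (\<Sum>r\<in>{1..n s}. U (n s) r (X s) * R_isolated k n S X s r)"
proof -
  define W where "W c = {w \<in> words k n. (\<forall>i\<in>S. run_lengths i w \<in> X i) \<and> run_lengths s w = c}" for c
  define C where "C r = {c \<in> compositions (n s) r. c \<in> X s}" for r
  have finC: "finite (C r)" for r
    by (simp add: C_def finite_compositions)
  have finW: "finite (W c)" for c
    by (simp add: W_def finite_words)
  have "{w \<in> words k n. \<forall>i\<in>insert s S. run_lengths i w \<in> X i} = (\<Union>r\<in>{1..n s}. \<Union>c\<in>C r. W c)"
  proof (intro set_eqI iffI)
    fix w assume w: "w \<in> {w \<in> words k n. \<forall>i\<in>insert s S. run_lengths i w \<in> X i}"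
    let ?c = "run_lengths s w"
    have sum: "sum_list ?c = n s"
      using w assms(1) by (auto simp: words_run_lengths)
    then have "?c \<in> C (length ?c)"
      using w by (auto simp: C_def compositions_def dest: run_lengths_pos)
    moreover have "?c \<noteq> []"
      using sum assms(3) by auto
    moreover have "length ?c \<le> sum_list ?c"
    proof -
      have "length c \<le> sum_list c" if "\<forall>m\<in>set c. 0 < m" for c :: "nat list"
        using that by (induction c) (auto simp: Suc_le_eq)
      then show ?thesis by (metis run_lengths_pos)
    qed
    ultimately show "w \<in> (\<Union>r\<in>{1..n s}. \<Union>c\<in>C r. W c)"
      using w sum by (auto simp: W_def Suc_le_eq intro!: bexI[of _ "length ?c"])
  qed (auto simp: C_def W_def)
  then have "R k n (insert s S) X = card (\<Union>r\<in>{1..n s}. \<Union>c\<in>C r. W c)"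
    by (simp add: R_def)
  also have "\<dots> = (\<Sum>r\<in>{1..n s}. card (\<Union>c\<in>C r. W c))"
    by (rule card_UN_disjoint) (auto simp: finC finW, auto simp: C_def W_def compositions_def)
  also have "\<dots> = (\<Sum>r\<in>{1..n s}. \<Sum>c\<in>C r. card (W c))"
    by (intro sum.cong refl card_UN_disjoint) (auto simp: finC finW, auto simp: W_def)
  also have "\<dots> = (\<Sum>r\<in>{1..n s}. \<Sum>c\<in>C r. R_isolated k n S X s r)"
    unfolding W_def by (intro sum.cong refl card_run_lengths_eq_R_isolated assms) (simp add: C_def)
  finally show ?thesis
    by (simp add: C_def U_def)
qed

text \<open>Imposing the trivial restriction \<open>UNIV\<close> on \<open>s\<close> changes
  nothing, so \<open>R_insert_eq_sum\<close> writes the count with \<open>m\<close> copies of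
  \<open>s\<close> as a binomial transform of the isolated counts, which is then inverted.\<close>

lemma R_isolated_eq_sum:
  assumes "s \<in> {1..k}" and "s \<notin> S" and "1 \<le> r"
  shows "real (R_isolated k n S X s r) =
    (\<Sum>p\<in>{1..r}. (-1) ^ (r - p) * real ((r - 1) choose (p - 1)) * real (R k (n(s := p)) S X))"
proof (rule binomial_inversion_from_1[OF _ assms(3)])
  fix m :: nat assume m: "1 \<le> m"
  let ?Y = "X(s := UNIV)"
  have "R k (n(s := m)) S X = R k (n(s := m)) (insert s S) ?Y"
    using assms(2) by (auto simp: R_def intro!: arg_cong[where f = card])
  also have "\<dots> = (\<Sum>j\<in>{1..m}. U m j UNIV * R_isolated k (n(s := m)) S ?Y s j)"
    using R_insert_eq_sum[OF assms(1,2), of "n(s := m)" ?Y] m by simp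
  also have "\<dots> = (\<Sum>j\<in>{1..m}. ((m - 1) choose (j - 1)) * R_isolated k n S X s j)"
  proof (intro sum.cong refl)
    fix j assume "j \<in> {1..m}"
    then have "U m j UNIV = (m - 1) choose (j - 1)"
      by (simp add: U_def card_compositions)
    \<comment> \<open>The value \<open>m\<close> is overwritten by \<open>j\<close>, so the isolated
      counts form one sequence valid for all \<open>m\<close>, as inversion requires.\<close>
    moreover have "R_isolated k (n(s := m)) S ?Y s j = R_isolated k n S X s j"
      unfolding R_isolated_def using assms(2) by (intro arg_cong[where f = card]) auto
    ultimately show "U m j UNIV * R_isolated k (n(s := m)) S ?Y s j = ((m - 1) choose (j - 1)) * R_isolated k n S X s j"
      by simp
  qed
  finally show "real (R k (n(s := m)) S X) =
      (\<Sum>j\<in>{1..m}. real ((m - 1) choose (j - 1)) * real (R_isolated k n S X s j))"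
    by simp
qed

section \<open>Induction over the set of restricted letters\<close>

lemma sum_PiE_insert:
  assumes "s \<notin> S"
  shows "(\<Sum>f\<in>Pi\<^sub>E (insert s S) B. h f) = (\<Sum>y\<in>B s. \<Sum>g\<in>Pi\<^sub>E S B. h (g(s := y)))"
proof -
  have "(\<Sum>f\<in>Pi\<^sub>E (insert s S) B. h f) = (\<Sum>(y, g)\<in>B s \<times> Pi\<^sub>E S B. h (g(s := y)))"
    unfolding PiE_insert_eq
    by (subst sum.reindex[OF inj_combinator[OF assms]]) (simp add: case_prod_beta comp_def)
  then show ?thesis
    by (simp add: sum.cartesian_product)
qed

text \<open>The induction on \<open>S\<close> keeps \<open>n\<close> arbitrary, because removing the
  restriction on \<open>s\<close> leads to words with \<open>p s\<close> instead of
  \<open>n s\<close> copies of \<open>s\<close>. With no restricted letter, the formula is the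
  multinomial coefficient.\<close>

lemma R_eq_sum:
  assumes "finite S" and "S \<subseteq> {1..k}" and "\<And>i. i \<in> {1..k} \<Longrightarrow> 1 \<le> n i"
  shows "real (R k n S X) =
    (\<Sum>r \<in> (\<Pi>\<^sub>E i\<in>S. {1..n i}). \<Sum>p \<in> (\<Pi>\<^sub>E i\<in>S. {1..r i}).
      fact ((\<Sum>i\<in>S. p i) + (\<Sum>i\<in>{1..k} - S. n i))
        / ((\<Prod>i\<in>S. fact (p i)) * (\<Prod>i\<in>{1..k} - S. fact (n i)))
      * (\<Prod>i\<in>S. (- 1) ^ (r i - p i) * real ((r i - 1) choose (p i - 1)) * real (U (n i) (r i) (X i))))"
  using assms
proof (induction S arbitrary: n rule: finite_induct)
  case empty
  then show ?case
    using card_words[of k n] by (simp add: R_def)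
next
  case (insert s S)
  define F where "F n S r p =
    fact ((\<Sum>i\<in>S. p i) + (\<Sum>i\<in>{1..k} - S. n i))
      / ((\<Prod>i\<in>S. fact (p i)) * (\<Prod>i\<in>{1..k} - S. fact (n i)))
    * (\<Prod>i\<in>S. (- 1) ^ (r i - p i) * real ((r i - 1) choose (p i - 1)) * real (U (n i) (r i) (X i)))"
    for n S and r p :: "nat \<Rightarrow> nat"
  define c where "c r p = (- 1) ^ (r - p) * real ((r - 1) choose (p - 1))" for r p :: nat
  have s: "s \<in> {1..k}" "s \<notin> S" "1 \<le> n s"
    using insert.prems insert.hyps by auto
  have not_s: "i \<noteq> s" if "i \<in> S" for i
    using that s(2) by blast
  \<comment> \<open>On the right \<open>s\<close> is an unrestricted letter with \<open>b\<close>
    copies, on the left a restricted one with \<open>p s = b\<close>. The multinomial coefficient is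
    the same, and only the factor for \<open>s\<close> is split off.\<close>
  have F: "F n (insert s S) (r(s := a)) (p(s := b)) = U (n s) a (X s) * (c a b * F (n(s := b)) S r p)"
    for a b r p
  proof -
    have compl: "{1..k} - S = insert s ({1..k} - insert s S)"
      using s by auto
    have upd: "(\<Sum>i\<in>S. (p(s := b)) i) = (\<Sum>i\<in>S. p i)"
      "(\<Prod>i\<in>S. fact ((p(s := b)) i)) = (\<Prod>i\<in>S. fact (p i) :: real)"
      "(\<Sum>i\<in>{1..k} - insert s S. (n(s := b)) i) = (\<Sum>i\<in>{1..k} - insert s S. n i)"
      "(\<Prod>i\<in>{1..k} - insert s S. fact ((n(s := b)) i)) = (\<Prod>i\<in>{1..k} - insert s S. fact (n i) :: real)"
      "(\<Prod>i\<in>S. (- 1) ^ ((r(s := a)) i - (p(s := b)) i)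
          * real (((r(s := a)) i - 1) choose ((p(s := b)) i - 1)) * real (U (n i) ((r(s := a)) i) (X i))) =
        (\<Prod>i\<in>S. (- 1) ^ (r i - p i) * real ((r i - 1) choose (p i - 1)) * real (U (n i) (r i) (X i)))"
      "(\<Prod>i\<in>S. (- 1) ^ (r i - p i)
          * real ((r i - 1) choose (p i - 1)) * real (U ((n(s := b)) i) (r i) (X i))) =
        (\<Prod>i\<in>S. (- 1) ^ (r i - p i) * real ((r i - 1) choose (p i - 1)) * real (U (n i) (r i) (X i)))"
      by (auto intro!: sum.cong prod.cong dest: not_s)
    have fin: "finite ({1..k} - insert s S)" "s \<notin> {1..k} - insert s S"
      by auto
    show ?thesis
      unfolding F_def c_def compl sum.insert[OF insert.hyps] prod.insert[OF insert.hyps]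
        sum.insert[OF fin] prod.insert[OF fin] upd
      by (simp add: mult_ac add_ac)
  qed
  have IH: "real (R k (n(s := b)) S X) =
      (\<Sum>r \<in> (\<Pi>\<^sub>E i\<in>S. {1..n i}). \<Sum>p \<in> (\<Pi>\<^sub>E i\<in>S. {1..r i}). F (n(s := b)) S r p)" if "1 \<le> b" for b
  proof -
    have "(\<Pi>\<^sub>E i\<in>S. {1..(n(s := b)) i}) = (\<Pi>\<^sub>E i\<in>S. {1..n i})"
      by (intro PiE_cong) (simp add: not_s)
    moreover have "S \<subseteq> {1..k}" "\<And>i. i \<in> {1..k} \<Longrightarrow> 1 \<le> (n(s := b)) i"
      using insert.prems that by auto
    note insert.IH[OF this, folded F_def]
    ultimately show ?thesis
      by (simp only:)
  qed
  have PiE_upd: "(\<Pi>\<^sub>E i\<in>S. {1..(r(s := a)) i}) = (\<Pi>\<^sub>E i\<in>S. {1..r i})" for r a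
    by (intro PiE_cong) (simp add: not_s)
  have "real (R k n (insert s S) X) =
      (\<Sum>a\<in>{1..n s}. real (U (n s) a (X s)) * (\<Sum>b\<in>{1..a}. c a b * real (R k (n(s := b)) S X)))"
    unfolding R_insert_eq_sum[where n = n, OF s] of_nat_sum of_nat_mult c_def
    by (intro sum.cong refl) (simp add: R_isolated_eq_sum[OF s(1,2)])
  also have "\<dots> = (\<Sum>a\<in>{1..n s}. \<Sum>b\<in>{1..a}. \<Sum>r \<in> (\<Pi>\<^sub>E i\<in>S. {1..n i}). \<Sum>p \<in> (\<Pi>\<^sub>E i\<in>S. {1..r i}).
      F n (insert s S) (r(s := a)) (p(s := b)))"
    by (intro sum.cong refl) (simp add: sum_distrib_left IH F)
  \<comment> \<open>The range of \<open>b\<close> depends on \<open>a\<close> but not on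
    \<open>r\<close>. After the swap \<open>a\<close> stands next to \<open>r\<close> and
    \<open>b\<close> next to \<open>p\<close>, ready to be merged by
    \<open>sum_PiE_insert\<close>.\<close>
  also have "\<dots> = (\<Sum>a\<in>{1..n s}. \<Sum>r \<in> (\<Pi>\<^sub>E i\<in>S. {1..n i}). \<Sum>b\<in>{1..a}. \<Sum>p \<in> (\<Pi>\<^sub>E i\<in>S. {1..r i}).
      F n (insert s S) (r(s := a)) (p(s := b)))"
    by (intro sum.cong refl sum.swap)
  also have "\<dots> = (\<Sum>r \<in> (\<Pi>\<^sub>E i\<in>insert s S. {1..n i}). \<Sum>p \<in> (\<Pi>\<^sub>E i\<in>insert s S. {1..r i}).
      F n (insert s S) r p)"
    by (simp only: sum_PiE_insert[OF s(2)] PiE_upd fun_upd_same)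
  finally show ?case
    by (simp only: F_def)
qed

theorem theorem1:
  fixes k :: nat and n :: "nat \<Rightarrow> nat" and S :: "nat set" and X :: "nat \<Rightarrow> nat list set"
  assumes "k \<ge> 1"
    and "\<And>i. i \<in> {1..k} \<Longrightarrow> n i \<ge> 1"
    and "S \<subseteq> {1..k}"
  shows "real (R k n S X) =
    (\<Sum>r \<in> (\<Pi>\<^sub>E i\<in>S. {1..n i}). \<Sum>p \<in> (\<Pi>\<^sub>E i\<in>S. {1..r i}).
      fact ((\<Sum>i\<in>S. p i) + (\<Sum>i\<in>{1..k} - S. n i))
        / ((\<Prod>i\<in>S. fact (p i)) * (\<Prod>i\<in>{1..k} - S. fact (n i)))
      * (\<Prod>i\<in>S. (- 1) ^ (r i - p i) * real ((r i - 1) choose (p i - 1)) * real (U (n i) (r i) (X i))))"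
  by (rule R_eq_sum[OF finite_subset[OF assms(3) finite_atLeastAtMost] assms(3,2)])

end
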